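(* Let $(X_t)_{t\in\mathbb{Z}}$ be the CM3 process with parameter functions $a_i^{(j)}$ ($i\in\mathbb{Z}_+$, $j\in\mathbb{Z}$), and assume $\sum_{j\in\mathbb{Z}}\sum_{i\geqslant 0}\|a_i^{(j)}\|_\infty<\infty$. Then the extremal index of the univariate time series $(\|X_t\|_\infty)_{t\in\mathbb{Z}}$ is $$\theta=\frac{1}{\sum_{j\in\mathbb{Z}}\sum_{i\geqslant 0}\|a_i^{(j)}\|_\infty}\ \sum_{j\in\mathbb{Z}}\max_{i\geqslant 0}\|a_i^{(j)}\|_\infty.$$
   Context: Fix an integer $q\geqslant 1$. $\mathbb{Z}_+=\{0,1,2,\ldots\}$. For $f:[0,1]^q\to\mathbb{R}$, $\|f\|_\infty=\sup_{x\in[0,1]^q}|f(x)|$. A unit-Fréchet random variable $Z$ satisfies $P(Z\leqslant z)=\exp(-1/z)$ for $z>0$. CM3 process: let $a_i^{(j)}:[0,1]^q\to(0,\infty)$ ($i\in\mathbb{Z}_+$, $j\in\mathbb{Z}$) be deterministic, strictly positive, continuous functions (the parameter functions) and let $Z_i^{(j)}$ ($i\in\mathbb{Z}$, $j\in\mathbb{Z}$) be independent unit-Fréchet random variables. The CM3 process is $X_t(x)=\sup_{j\in\mathbb{Z}}\sup_{i\geqslant0}(a_i^{(j)}(x)Z_{t-i}^{(j)})$, $x\in[0,1]^q$, $t\in\mathbb{Z}$. Under the summability assumption of the claim, the process is stationary and each $X_t$ is (up to a null event) a random continuous function. Extremal index: let $(X_t)_{t\in\mathbb{Z}}$ be stationary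 with $c:=\lim_{x\to\infty}x\,P(\|X_0\|_\infty>x)\in(0,\infty)$. The extremal index of $(\|X_t\|_\infty)_{t\in\mathbb{Z}}$ is the number $\theta\in[0,1]$ such that, for every $x>0$, $P(\max_{1\leqslant t\leqslant n}\|X_t\|_\infty\leqslant nx)\to e^{-\theta c/x}$ as $n\to\infty$. *)

theory Defs
  imports "HOL-Probability.Probability"
begin

text \<open>
  The supremum norm on the cube \<open>[0,1]\<^sup>q\<close>, with \<open>q = CARD('q)\<close>. It is polymorphic in the codomain: it
  is used for the real parameter functions (where the supremum is meaningful because they are
  continuous, hence bounded, on the cube) and for extended-real sample paths.
\<close>

definition sup_norm :: "(real^'q \<Rightarrow> 'b::{abs,Sup}) \<Rightarrow> 'b" where
  "sup_norm f = (SUP x\<in>cbox 0 1. \<bar>f x\<bar>)"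

definition unit_frechet :: "'a measure \<Rightarrow> ('a \<Rightarrow> real) \<Rightarrow> bool" where
  "unit_frechet M Z \<longleftrightarrow> Z \<in> borel_measurable M \<and>
     (\<forall>z>0. measure M {\<omega>\<in>space M. Z \<omega> \<le> z} = exp (- 1 / z))"

text \<open>
  \<open>cm3 a Z t \<omega> x\<close> is \<open>X\<^sub>t(x)\<close> at the outcome \<open>\<omega>\<close>, where \<open>a i j\<close> and \<open>Z i j\<close> stand for the parameter function
  and the innovation with subscript \<open>i\<close> and superscript \<open>j\<close>. Values are extended reals since
  the supremum of the series can be infinite on a null event.
\<close>

definition cm3 :: "(nat \<Rightarrow> int \<Rightarrow> real^'q \<Rightarrow> real) \<Rightarrow> (int \<Rightarrow> int \<Rightarrow> 'a \<Rightarrow> real) \<Rightarrow>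
    int \<Rightarrow> 'a \<Rightarrow> real^'q \<Rightarrow> ereal" where
  "cm3 a Z t \<omega> x = (SUP j. SUP i. ereal (a i j x * Z (t - int i) j \<omega>))"

definition stationary :: "'a measure \<Rightarrow> (int \<Rightarrow> 'a \<Rightarrow> ereal) \<Rightarrow> bool" where
  "stationary M Y \<longleftrightarrow> (\<forall>t. Y t \<in> borel_measurable M) \<and>
     (\<forall>h. distr M (Pi\<^sub>M UNIV (\<lambda>_. borel)) (\<lambda>\<omega> t. Y (t + h) \<omega>) =
          distr M (Pi\<^sub>M UNIV (\<lambda>_. borel)) (\<lambda>\<omega> t. Y t \<omega>))"

text \<open>
  A relation rather than a function of the series; \<open>\<theta>\<close> is unique because the tail constant \<open>c\<close> is
  positive.
\<close>

definition has_extremal_index :: "'a measure \<Rightarrow> (int \<Rightarrow> 'a \<Rightarrow> ereal) \<Rightarrow> real \<Rightarrow> bool" where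
  "has_extremal_index M Y \<theta> \<longleftrightarrow> stationary M Y \<and> 0 \<le> \<theta> \<and> \<theta> \<le> 1 \<and>
     (\<exists>c>0. ((\<lambda>x. x * measure M {\<omega>\<in>space M. Y 0 \<omega> > ereal x}) \<longlongrightarrow> c) at_top \<and>
       (\<forall>x>0. (\<lambda>n::nat. measure M {\<omega>\<in>space M. (MAX t\<in>{1..int n}. Y t \<omega>) \<le> ereal (real n * x)})
          \<longlonglongrightarrow> exp (- \<theta> * c / x)))"

end

theory Submission
  imports Defs "HOL-Real_Asymp.Real_Asymp"
begin

text \<open>
  Write \<open>\<alpha> j i\<close> for \<open>\<parallel>a i j\<parallel>\<close>, and let \<open>A\<close> be the sum of all \<open>\<alpha> j i\<close> and \<open>B\<close> the sum over \<open>j\<close> of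
  \<open>sup\<^sub>i (\<alpha> j i)\<close>. Almost surely all shocks are positive, and then taking norms commutes with the
  suprema that define the process: \<open>\<parallel>X\<^sub>t\<parallel>\<close> is the supremum of \<open>\<alpha> j i\<close> times the shock of series \<open>j\<close> at
  time \<open>t - i\<close>. Its maximum over \<open>t = 1, \<dots>, n\<close> is therefore a max-linear combination of independent
  unit-Frechet variables, in which the shock of series \<open>j\<close> at time \<open>s\<close> has as coefficient the maximum of
  \<open>\<alpha> j i\<close> over those lags \<open>i\<close> for which \<open>s + i\<close> lies between \<open>1\<close> and \<open>n\<close>. Such a combination is Frechet with
  scale the sum \<open>S n\<close> of the coefficients (\<open>unit_frechet_max_linear\<close>), so the maximum is at most
  \<open>n * x\<close> with probability \<open>exp (- S n / (n * x))\<close> (\<open>prob_cm3_window_le\<close>). The case \<open>n = 1\<close> has \<open>S 1 = A\<close>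
  and gives the tail constant \<open>A\<close>; the extremal index is \<open>B / A\<close> once \<open>S n / n\<close> tends to \<open>B\<close>.

  For this limit (\<open>window_max_sum_asymptotics\<close>), extend a window of length \<open>n\<close> by one time point at its
  beginning. The coefficient of the shock \<open>r\<close> steps before the new point grows by the excess of \<open>\<alpha> j r\<close>
  over the maximum of the \<open>n\<close> entries that follow it. By dominated convergence the total growth
  tends to the sum of the excesses of \<open>\<alpha> j r\<close> over \<open>sup\<^bsub>i>r\<^esub> (\<alpha> j i)\<close>. For each \<open>j\<close> these are the
  differences of consecutive tail suprema and add up to \<open>sup\<^sub>i (\<alpha> j i)\<close>. So the increments of \<open>S\<close> tend
  to \<open>B\<close>, and so do the averages \<open>S n / n\<close>.

  Stationarity holds because the norms are a function of the i.i.d. shocks that commutes with time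
  shifts. The work lies in showing this function measurable at every outcome, including those with
  negative shocks; a compactness argument of Dini type does this (\<open>measurable_sup_norm_cm3\<close>).
\<close>

section \<open>Averages and dominated convergence for unordered sums\<close>

text \<open>
  An absolutely convergent unordered sum is an integral with respect to the counting measure.
\<close>

lemma infsum_dominated_convergence:
  fixes f :: "nat \<Rightarrow> 'i \<Rightarrow> real"
  assumes lim: "\<And>p. (\<lambda>n. f n p) \<longlonglongrightarrow> g p"
    and bound: "\<And>n p. \<bar>f n p\<bar> \<le> w p"
    and w: "w summable_on UNIV"
  shows "(\<lambda>n. infsum (f n) UNIV) \<longlonglongrightarrow> infsum g UNIV"
proof -
  have w_int: "integrable (count_space UNIV) w"
  proof -
    have "w p \<ge> 0" for p using bound[of 0 p] by linarith
    then have "(\<lambda>p. norm (w p)) summable_on UNIV" using w by simp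
    then show ?thesis
      unfolding abs_summable_equivalent Infinite_Set_Sum.abs_summable_on_def .
  qed
  have infsum_eq: "infsum h UNIV = (LINT p|count_space UNIV. h p)"
    if "\<And>p. \<bar>h p\<bar> \<le> w p" for h :: "'i \<Rightarrow> real"
  proof -
    have "integrable (count_space UNIV) h"
      by (rule Bochner_Integration.integrable_bound[OF w_int])
         (auto simp: AE_count_space intro: order_trans[OF that abs_ge_self])
    then show ?thesis
      using infsetsum_infsum[of h UNIV]
      by (simp add: Infinite_Set_Sum.abs_summable_on_def infsetsum_def)
  qed
  have g_bound: "\<bar>g p\<bar> \<le> w p" for p
    by (rule LIMSEQ_le_const2[OF tendsto_rabs[OF lim]]) (use bound in auto)
  have "(\<lambda>n. LINT p|count_space UNIV. f n p) \<longlonglongrightarrow> (LINT p|count_space UNIV. g p)"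
    by (rule integral_dominated_convergence[where w = w])
       (use w_int bound lim in auto)
  then show ?thesis
    using infsum_eq[OF bound] infsum_eq[OF g_bound] by simp
qed

text \<open>
  The Stolz--Cesaro theorem for averages. After subtracting \<open>n * L\<close> the increments are eventually
  below \<open>e / 2\<close>, so that the accumulated error is at most a constant plus \<open>n * e / 2\<close>.
\<close>

lemma LIMSEQ_mean_of_increments:
  fixes S :: "nat \<Rightarrow> real"
  assumes "(\<lambda>n. S (Suc n) - S n) \<longlonglongrightarrow> L"
  shows "(\<lambda>n. S n / n) \<longlonglongrightarrow> L"
proof -
  define E where "E n = S n - n * L" for n
  have "(\<lambda>n. E (Suc n) - E n) \<longlonglongrightarrow> 0"
    using tendsto_diff[OF assms tendsto_const[of L]] by (simp add: E_def algebra_simps)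
  have "(\<lambda>n. E n / n) \<longlonglongrightarrow> 0"
  proof (rule LIMSEQ_I)
    fix e :: real assume e: "e > 0"
    from LIMSEQ_D[OF \<open>(\<lambda>n. E (Suc n) - E n) \<longlonglongrightarrow> 0\<close>, of "e / 2"] e
    obtain N where N: "\<And>n. n \<ge> N \<Longrightarrow> \<bar>E (Suc n) - E n\<bar> < e / 2" by auto
    have tail: "\<bar>E (N + k)\<bar> \<le> \<bar>E N\<bar> + k * (e / 2)" for k
    proof (induction k)
      case (Suc k)
      moreover have "real (Suc k) * (e / 2) = real k * (e / 2) + e / 2" by (simp add: algebra_simps)
      moreover have "\<bar>E (Suc (N + k)) - E (N + k)\<bar> < e / 2" by (rule N) simp
      ultimately show ?case unfolding add_Suc_right by linarith
    qed simp
    obtain N' where N': "real N' > 2 * \<bar>E N\<bar> / e" using reals_Archimedean2 by blast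
    have "norm (E n / n - 0) < e" if n: "n \<ge> max (Suc N) N'" for n
    proof -
      from n have n0: "real n > 0" by simp
      have "\<bar>E n\<bar> \<le> \<bar>E N\<bar> + real (n - N) * (e / 2)" using tail[of "n - N"] n by simp
      also have "\<dots> \<le> \<bar>E N\<bar> + real n * (e / 2)" using e by simp
      also have "\<bar>E N\<bar> < real n * (e / 2)"
      proof -
        have "2 * \<bar>E N\<bar> / e < real n" using N' n by simp
        then show ?thesis using e by (simp add: field_simps)
      qed
      finally have "\<bar>E n\<bar> < real n * e" by (simp add: mult.commute)
      then show ?thesis using n0 by (simp add: pos_divide_less_eq mult.commute)
    qed
    then show "\<exists>no. \<forall>n\<ge>no. norm (E n / n - 0) < e" by blast
  qed
  from tendsto_add[OF this tendsto_const[of L]]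
  have "(\<lambda>n. E n / n + L) \<longlonglongrightarrow> L" by simp
  moreover have "\<forall>\<^sub>F n in sequentially. E n / n + L = S n / n"
    using eventually_gt_at_top[of 0] by eventually_elim (simp add: E_def field_simps)
  ultimately show ?thesis by (rule Lim_transform_eventually)
qed

section \<open>Maxima of a coefficient sequence over a sliding window\<close>

definition zero_extension :: "(nat \<Rightarrow> real) \<Rightarrow> int \<Rightarrow> real" where
  "zero_extension u k = (if k < 0 then 0 else u (nat k))"

text \<open>
  \<open>window_max u n s\<close> is the largest factor with which a shock at time \<open>s\<close> enters the observations at
  times \<open>1, \<dots>, n\<close>, when \<open>u i\<close> is its factor after \<open>i\<close> time steps. The recursion splits off time
  \<open>1\<close>, so that the gain over the shorter window is the excess of one entry of \<open>u\<close> over the entries that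
  follow it; such excesses telescope in the limit.
\<close>

primrec window_max :: "(nat \<Rightarrow> real) \<Rightarrow> nat \<Rightarrow> int \<Rightarrow> real" where
  "window_max u 0 s = 0"
| "window_max u (Suc n) s = max (zero_extension u (1 - s)) (window_max u n (s - 1))"

lemma window_max_nonneg: "window_max u n s \<ge> 0"
  by (induction n arbitrary: s) (auto simp: le_max_iff_disj)

lemma window_max_le_iff:
  assumes "c \<ge> 0"
  shows "window_max u n s \<le> c \<longleftrightarrow> (\<forall>t\<in>{1..int n}. zero_extension u (t - s) \<le> c)"
proof (induction n arbitrary: s)
  case (Suc n)
  have split: "{1..int (Suc n)} = insert 1 ((\<lambda>t. t + 1) ` {1..int n})"
    by (auto simp: image_iff)
  have "window_max u (Suc n) s \<le> c \<longleftrightarrow>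
      zero_extension u (1 - s) \<le> c \<and> (\<forall>t\<in>{1..int n}. zero_extension u (t - (s - 1)) \<le> c)"
    by (simp add: Suc.IH)
  also have "\<dots> \<longleftrightarrow>
      (\<forall>t\<in>insert 1 ((\<lambda>t. t + 1) ` {1..int n}). zero_extension u (t - s) \<le> c)"
    unfolding diff_diff_eq2 by blast
  finally show ?case by (simp only: split)
qed (use assms in simp)

lemma window_max_before_le_iff:
  assumes "c \<ge> 0"
  shows "window_max u n (- int r) \<le> c \<longleftrightarrow> (\<forall>k\<in>{r<..r + n}. u k \<le> c)"
proof -
  have "(\<forall>t\<in>{1..int n}. zero_extension u (t - - int r) \<le> c) \<longleftrightarrow> (\<forall>k\<in>{r<..r + n}. u k \<le> c)"
  proof (intro iffI ballI)
    fix k assume *: "\<forall>t\<in>{1..int n}. zero_extension u (t - - int r) \<le> c" and "k \<in> {r<..r + n}"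
    then have "int k - int r \<in> {1..int n}" by auto
    from bspec[OF * this] show "u k \<le> c" by (simp add: zero_extension_def)
  next
    fix t assume *: "\<forall>k\<in>{r<..r + n}. u k \<le> c" and t: "t \<in> {1..int n}"
    then have "nat (t + int r) \<in> {r<..r + n}" by auto
    from bspec[OF * this] t show "zero_extension u (t - - int r) \<le> c" by (simp add: zero_extension_def)
  qed
  then show ?thesis by (simp only: window_max_le_iff[OF assms])
qed

lemma window_max_before_tendsto:
  assumes u: "\<And>i. u i \<ge> 0" and bdd: "bdd_above (range u)"
  shows "(\<lambda>n. window_max u n (- int r)) \<longlonglongrightarrow> (SUP i\<in>{r<..}. u i)"
proof (rule order_tendstoI)
  have bdd': "bdd_above (u ` {r<..})" by (rule bdd_above_mono[OF bdd]) auto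
  have sup_ge: "u k \<le> (SUP i\<in>{r<..}. u i)" if "k > r" for k
    by (rule cSUP_upper[OF _ bdd']) (use that in simp)
  have sup_nonneg: "0 \<le> (SUP i\<in>{r<..}. u i)"
    using u[of "Suc r"] sup_ge[of "Suc r"] by simp
  fix c
  {
    assume c: "(SUP i\<in>{r<..}. u i) < c"
    have "window_max u n (- int r) \<le> (SUP i\<in>{r<..}. u i)" for n
      using sup_ge by (subst window_max_before_le_iff[OF sup_nonneg]) auto
    with c show "\<forall>\<^sub>F n in sequentially. window_max u n (- int r) < c"
      by (intro always_eventually allI) (rule le_less_trans)
  }
  assume c: "c < (SUP i\<in>{r<..}. u i)"
  show "\<forall>\<^sub>F n in sequentially. c < window_max u n (- int r)"
  proof (cases "c < 0")
    case True
    then show ?thesis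
      by (intro always_eventually allI) (rule less_le_trans[OF _ window_max_nonneg])
  next
    case False
    obtain k where k: "k > r" "c < u k"
      using c less_cSUP_iff[OF _ bdd'] by (auto simp: greaterThan_non_empty)
    have "c < window_max u n (- int r)" if "n \<ge> k" for n
      using k that False window_max_before_le_iff[of c u n r] by (auto simp: not_le[symmetric])
    then show ?thesis by (auto simp: eventually_sequentially)
  qed
qed

text \<open>
  With the tail suprema \<open>T r = sup {u i | i \<ge> r}\<close> we have \<open>T r = max (u r) (T (r + 1))\<close>, so the terms
  are the differences \<open>T r - T (r + 1)\<close> and the sum telescopes.
\<close>

lemma excess_over_tail_has_sum:
  fixes u :: "nat \<Rightarrow> real"
  assumes u: "\<And>i. u i \<ge> 0" and lim: "u \<longlonglongrightarrow> 0"
  shows "((\<lambda>r. max 0 (u r - (SUP i\<in>{r<..}. u i))) has_sum (SUP i. u i)) UNIV"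
proof -
  define T where "T r = (SUP i\<in>{r..}. u i)" for r
  have bdd: "bdd_above (range u)"
    by (rule bounded_imp_bdd_above[OF convergent_imp_bounded[OF lim]])
  have bdd': "bdd_above (u ` A)" for A by (rule bdd_above_mono[OF bdd]) auto
  have T_step: "T r = max (u r) (T (Suc r))" for r
  proof -
    have "{r..} = insert r {Suc r..}" by auto
    then show ?thesis
      unfolding T_def by (simp only:) (subst cSUP_insert[OF _ bdd'], auto simp: sup_max)
  qed
  have "T \<longlonglongrightarrow> 0"
  proof (rule order_tendstoI)
    fix c :: real
    have T_ge: "0 \<le> T r" for r
      using u[of r] cSUP_upper[OF _ bdd', of r "{r..}"] by (simp add: T_def)
    show "\<forall>\<^sub>F r in sequentially. c < T r" if "c < 0"
      using that by (intro always_eventually allI) (rule less_le_trans[OF _ T_ge])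
    assume "0 < c"
    then have "\<forall>\<^sub>F r in sequentially. u r < c / 2" by (intro order_tendstoD(2)[OF lim]) simp
    then obtain N where N: "\<And>r. r \<ge> N \<Longrightarrow> u r < c / 2" by (auto simp: eventually_sequentially)
    have "T r < c" if "r \<ge> N" for r
    proof -
      have "T r \<le> c / 2"
        unfolding T_def using that N by (intro cSUP_least) (auto intro: less_imp_le)
      with \<open>0 < c\<close> show ?thesis by linarith
    qed
    then show "\<forall>\<^sub>F r in sequentially. T r < c" by (auto simp: eventually_sequentially)
  qed
  from telescope_sums'[OF this] have "(\<lambda>r. T r - T (Suc r)) sums (SUP i. u i)"
    by (simp add: T_def atLeast_0)
  moreover have "T r - T (Suc r) = max 0 (u r - (SUP i\<in>{r<..}. u i))" for r
  proof -
    have "{r<..} = {Suc r..}" by auto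
    then show ?thesis using T_step[of r] by (simp add: T_def max_def)
  qed
  ultimately show ?thesis
    by (intro sums_nonneg_imp_has_sum) simp_all
qed

text \<open>
  Time \<open>1\<close> is reached from the shock at time \<open>1 - r\<close> with factor \<open>\<alpha> j r\<close>, and the other \<open>n\<close> times of the
  window with the \<open>n\<close> entries after \<open>\<alpha> j r\<close>. Thus the sum of all window maxima grows by the total
  excess of the entries over the maxima of their \<open>n\<close> successors.
\<close>

lemma window_max_has_sum_Suc:
  fixes \<alpha> :: "int \<Rightarrow> nat \<Rightarrow> real"
  assumes \<alpha>: "\<And>j i. \<alpha> j i \<ge> 0" and summ: "(\<lambda>(j, i). \<alpha> j i) summable_on UNIV"
    and S: "((\<lambda>(s, j). window_max (\<alpha> j) n s) has_sum S) UNIV"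
  shows "((\<lambda>(s, j). window_max (\<alpha> j) (Suc n) s) has_sum
      S + (\<Sum>\<^sub>\<infinity>(j, r). max 0 (\<alpha> j r - window_max (\<alpha> j) n (- int r)))) UNIV"
proof -
  let ?excess = "\<lambda>(j, r). max 0 (\<alpha> j r - window_max (\<alpha> j) n (- int r))"
  let ?gain = "\<lambda>(s, j). max 0 (zero_extension (\<alpha> j) (1 - s) - window_max (\<alpha> j) n (s - 1))"
  have "?excess summable_on UNIV"
    by (rule summable_on_comparison_test[OF summ])
       (use \<alpha> window_max_nonneg in \<open>auto simp: max_def\<close>)
  then have "(?excess has_sum infsum ?excess UNIV) UNIV" by (rule has_sum_infsum)
  \<comment> \<open>Factor \<open>r\<close> leads to time \<open>1\<close> from time \<open>1 - r\<close>; shocks after time \<open>1\<close> contribute nothing.\<close>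
  also have "?this \<longleftrightarrow> (?gain has_sum infsum ?excess UNIV) {(s, j). s \<le> 1}"
    by (rule has_sum_reindex_bij_witness[where i = "\<lambda>(s, j). (j, nat (1 - s))"
          and j = "\<lambda>(j, r). (1 - int r, j)"])
       (auto simp: zero_extension_def)
  also have "\<dots> \<longleftrightarrow> (?gain has_sum infsum ?excess UNIV) UNIV"
    by (rule has_sum_cong_neutral) (auto simp: zero_extension_def window_max_nonneg max_def
        intro: antisym)
  finally have gain: "(?gain has_sum infsum ?excess UNIV) UNIV" .
  have "((\<lambda>(s, j). window_max (\<alpha> j) n (s - 1)) has_sum S) UNIV \<longleftrightarrow>
      ((\<lambda>(s, j). window_max (\<alpha> j) n s) has_sum S) UNIV"
    by (rule has_sum_reindex_bij_witness[where i = "\<lambda>(s, j). (s + 1, j)" and j = "\<lambda>(s, j). (s - 1, j)"])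
       auto
  with S have "((\<lambda>(s, j). window_max (\<alpha> j) n (s - 1)) has_sum S) UNIV" by simp
  from has_sum_add[OF this gain]
  have "((\<lambda>(s, j). window_max (\<alpha> j) n (s - 1) +
        max 0 (zero_extension (\<alpha> j) (1 - s) - window_max (\<alpha> j) n (s - 1)))
      has_sum S + infsum ?excess UNIV) UNIV"
    by (simp add: case_prod_unfold)
  moreover have "x + max 0 (y - x) = max y x" for x y :: real by simp
  ultimately show ?thesis by simp
qed

lemma nonneg_summable_on_bounds:
  fixes u :: "nat \<Rightarrow> real"
  assumes "\<And>i. u i \<ge> 0" and "u summable_on UNIV"
  shows "u \<longlonglongrightarrow> 0" and "bdd_above (range u)"
    and "0 \<le> (SUP i. u i)" and "(SUP i. u i) \<le> infsum u UNIV"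
proof -
  have le: "u i \<le> infsum u UNIV" for i
    using finite_sum_le_infsum[OF assms(2), of "{i}"] assms(1) by simp
  show bdd: "bdd_above (range u)" using le by (auto simp: bdd_above_def)
  show "u \<longlonglongrightarrow> 0"
    using has_sum_imp_sums[OF has_sum_infsum[OF assms(2)]] summable_LIMSEQ_zero sums_summable
    by blast
  show "0 \<le> (SUP i. u i)" using assms(1)[of 0] cSUP_upper[OF _ bdd, of 0] by simp
  show "(SUP i. u i) \<le> infsum u UNIV" by (rule cSUP_least) (auto intro: le)
qed

text \<open>
  The increments of the window sums converge to the sum of the maxima of the sequences, by dominated
  convergence and the telescoping identity; hence so do the averages.
\<close>

lemma window_max_sum_asymptotics:
  fixes \<alpha> :: "int \<Rightarrow> nat \<Rightarrow> real"
  assumes \<alpha>: "\<And>j i. \<alpha> j i \<ge> 0" and summ: "(\<lambda>(j, i). \<alpha> j i) summable_on UNIV"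
  obtains S where "\<And>n. ((\<lambda>(s, j). window_max (\<alpha> j) n s) has_sum S n) UNIV"
    and "S 1 = (\<Sum>\<^sub>\<infinity>(j, i). \<alpha> j i)"
    and "(\<lambda>n. S n / n) \<longlonglongrightarrow> (\<Sum>\<^sub>\<infinity>j. SUP i. \<alpha> j i)"
proof
  let ?excess = "\<lambda>n (j, r). max 0 (\<alpha> j r - window_max (\<alpha> j) n (- int r))"
  define S where "S n = (\<Sum>k<n. infsum (?excess k) UNIV)" for n
  show "((\<lambda>(s, j). window_max (\<alpha> j) n s) has_sum S n) UNIV" for n
  proof (induction n)
    case 0
    show ?case by (simp add: S_def case_prod_unfold)
  next
    case (Suc n)
    from window_max_has_sum_Suc[OF \<alpha> summ Suc] show ?case by (simp add: S_def del: window_max.simps)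
  qed
  show "S 1 = (\<Sum>\<^sub>\<infinity>(j, i). \<alpha> j i)"
    by (simp add: S_def \<alpha> max_def)
  have row: "\<alpha> j summable_on UNIV" for j
    using summable_on_SigmaD1[of \<alpha> UNIV "\<lambda>_. UNIV" j] summ by simp
  note bounds = nonneg_summable_on_bounds[of "\<alpha> j" for j, OF \<alpha> row]
  let ?peak = "\<lambda>(j, r). max 0 (\<alpha> j r - (SUP i\<in>{r<..}. \<alpha> j i))"
  have "(\<lambda>n. infsum (?excess n) UNIV) \<longlonglongrightarrow> infsum ?peak UNIV"
  proof (rule infsum_dominated_convergence[OF _ _ summ])
    show "(\<lambda>n. ?excess n p) \<longlonglongrightarrow> ?peak p" for p
      by (cases p) (auto intro!: tendsto_intros window_max_before_tendsto \<alpha> bounds)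
    show "\<bar>?excess n p\<bar> \<le> (case p of (j, i) \<Rightarrow> \<alpha> j i)" for n p
      using \<alpha> window_max_nonneg by (cases p) (auto simp: max_def)
  qed
  also have "infsum ?peak UNIV = (\<Sum>\<^sub>\<infinity>j. SUP i. \<alpha> j i)"
  proof -
    have "0 \<le> (SUP i\<in>{r<..}. \<alpha> j i)" for j r
    proof -
      have "bdd_above (\<alpha> j ` {r<..})" by (rule bdd_above_mono[OF bounds(2)[of j]]) auto
      then show ?thesis
        using \<alpha>[of j "Suc r"] cSUP_upper[of "Suc r" "{r<..}" "\<alpha> j"] by simp
    qed
    then have "?peak summable_on UNIV"
      by (intro summable_on_comparison_test[OF summ]) (use \<alpha> in \<open>auto simp: max_def\<close>)
    then have "infsum ?peak UNIV = (\<Sum>\<^sub>\<infinity>j. \<Sum>\<^sub>\<infinity>r. ?peak (j, r))"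
      using infsum_Sigma'_banach[of "\<lambda>j r. ?peak (j, r)" UNIV "\<lambda>_. UNIV"]
      by (simp add: case_prod_unfold)
    also have "\<dots> = (\<Sum>\<^sub>\<infinity>j. SUP i. \<alpha> j i)"
      using infsumI[OF excess_over_tail_has_sum[OF \<alpha> bounds(1)]] by simp
    finally show ?thesis .
  qed
  finally show "(\<lambda>n. S n / n) \<longlonglongrightarrow> (\<Sum>\<^sub>\<infinity>j. SUP i. \<alpha> j i)"
    by (intro LIMSEQ_mean_of_increments) (simp add: S_def)
qed

section \<open>Measurability of the supremum norm of the process\<close>

lemma SUP_dense_eq:
  fixes g :: "'a::topological_space \<Rightarrow> ereal"
  assumes "D \<subseteq> K" "K \<subseteq> closure D" "closed K" "continuous_on K g"
  shows "(SUP x\<in>K. g x) = (SUP x\<in>D. g x)"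
proof (rule antisym)
  have K: "closure D = K" using assms(1-3) by (simp add: closure_minimal subset_antisym)
  have "g ` closure D \<subseteq> {..(SUP x\<in>D. g x)}"
    by (rule image_closure_subset) (use assms(4) K in \<open>auto intro: SUP_upper\<close>)
  then show "(SUP x\<in>K. g x) \<le> (SUP x\<in>D. g x)" unfolding K by (auto intro: SUP_least)
qed (rule SUP_subset_mono[OF assms(1) order_refl])

lemma INF_dense_eq:
  fixes g :: "'a::topological_space \<Rightarrow> ereal"
  assumes "D \<subseteq> K" "K \<subseteq> closure D" "closed K" "continuous_on K g"
  shows "(INF x\<in>K. g x) = (INF x\<in>D. g x)"
proof (rule antisym)
  have K: "closure D = K" using assms(1-3) by (simp add: closure_minimal subset_antisym)
  have "g ` closure D \<subseteq> {(INF x\<in>D. g x)..}"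
    by (rule image_closure_subset) (use assms(4) K in \<open>auto intro: INF_lower\<close>)
  then show "(INF x\<in>D. g x) \<le> (INF x\<in>K. g x)" unfolding K by (auto intro: INF_greatest)
qed (rule INF_superset_mono[OF assms(1) order_refl])

lemma continuous_on_finite_SUP:
  fixes f :: "nat \<Rightarrow> 'a::topological_space \<Rightarrow> ereal"
  assumes "\<And>k. continuous_on K (f k)"
  shows "continuous_on K (\<lambda>x. SUP k\<in>{..n}. f k x)"
proof (induction n)
  case (Suc n)
  show ?case
    unfolding atMost_Suc by (simp add: sup_max continuous_on_max[OF assms Suc])
qed (simp add: assms)

text \<open>
  A supremum of continuous functions is only lower semicontinuous, so its infimum over \<open>K\<close> is not
  the infimum over a dense subset. By compactness (as in Dini's theorem) the infimum over \<open>K\<close>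
  nevertheless commutes with the increasing limit of the finite suprema.
\<close>

lemma INF_SUP_eq_SUP_INF_compact:
  fixes f :: "nat \<Rightarrow> 'a::topological_space \<Rightarrow> ereal"
  assumes K: "compact K" and f: "\<And>k. continuous_on K (f k)"
  shows "(INF x\<in>K. SUP k. f k x) = (SUP n. INF x\<in>K. SUP k\<in>{..n}. f k x)"
proof (rule antisym)
  show "(SUP n. INF x\<in>K. SUP k\<in>{..n}. f k x) \<le> (INF x\<in>K. SUP k. f k x)"
    by (intro SUP_least INF_mono bexI SUP_subset_mono) auto
  show "(INF x\<in>K. SUP k. f k x) \<le> (SUP n. INF x\<in>K. SUP k\<in>{..n}. f k x)"
  proof (rule dense_le)
    fix c assume c: "c < (INF x\<in>K. SUP k. f k x)"
    have "\<exists>U. open U \<and> U \<inter> K = (\<lambda>x. f k x) -` {c<..} \<inter> K" for k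
      using f[of k, unfolded continuous_on_open_invariant] by auto
    then obtain U where U: "\<And>k. open (U k)" "\<And>k. U k \<inter> K = f k -` {c<..} \<inter> K" by metis
    have "K \<subseteq> (\<Union>k. U k)"
    proof
      fix x assume x: "x \<in> K"
      then have "c < (SUP k. f k x)" using c by (auto intro: less_le_trans INF_lower)
      then obtain k where "c < f k x" by (auto simp: less_SUP_iff)
      then show "x \<in> (\<Union>k. U k)" using x U(2)[of k] by blast
    qed
    then obtain C where C: "finite C" "K \<subseteq> (\<Union>k\<in>C. U k)"
      using compactE_image[OF K, of UNIV U] U(1) by auto
    obtain n where n: "C \<subseteq> {..n}" using C(1) finite_nat_iff_bounded_le by auto
    have "c \<le> (SUP k\<in>{..n}. f k x)" if x: "x \<in> K" for x
    proof -
      obtain k where k: "k \<in> C" "x \<in> U k" using C(2) x by auto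
      have "x \<in> f k -` {c<..} \<inter> K" using k(2) x U(2)[of k] by blast
      then have "c \<le> f k x" by (auto intro: less_imp_le)
      also have "\<dots> \<le> (SUP k\<in>{..n}. f k x)" using k(1) n by (intro SUP_upper) auto
      finally show ?thesis .
    qed
    then have "c \<le> (INF x\<in>K. SUP k\<in>{..n}. f k x)" by (rule INF_greatest)
    then show "c \<le> (SUP n. INF x\<in>K. SUP k\<in>{..n}. f k x)" by (rule SUP_upper2[OF UNIV_I])
  qed
qed

lemma SUP_abs_ereal:
  fixes g :: "'a \<Rightarrow> ereal"
  shows "(SUP x\<in>K. \<bar>g x\<bar>) = max (SUP x\<in>K. g x) (- (INF x\<in>K. g x))"
proof -
  have "\<bar>y\<bar> = sup y (- y)" for y :: ereal
    by (cases y) (auto simp: sup_max max_def)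
  then have "(SUP x\<in>K. \<bar>g x\<bar>) = (SUP x\<in>K. sup (g x) (- g x))" by presburger
  also have "\<dots> = sup (SUP x\<in>K. g x) (SUP x\<in>K. - g x)"
    by (rule complete_lattice_class.SUP_sup_distrib[symmetric])
  finally show ?thesis by (simp only: ereal_SUP_uminus_eq sup_max)
qed

lemma measurable_SUP_abs_SUP:
  fixes f :: "nat \<Rightarrow> 'a::{metric_space, second_countable_topology} \<Rightarrow> 'b \<Rightarrow> ereal"
  assumes K: "compact K"
    and cont: "\<And>k \<omega>. continuous_on K (\<lambda>x. f k x \<omega>)"
    and meas: "\<And>k x. x \<in> K \<Longrightarrow> f k x \<in> borel_measurable N"
  shows "(\<lambda>\<omega>. SUP x\<in>K. \<bar>SUP k. f k x \<omega>\<bar>) \<in> borel_measurable N"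
proof -
  obtain D where D: "countable D" "D \<subseteq> K" "K \<subseteq> closure D" by (rule separable)
  note dense = D(2,3) compact_imp_closed[OF K]
  have "(SUP x\<in>K. SUP k. f k x \<omega>) = (SUP k. SUP x\<in>D. f k x \<omega>)" for \<omega>
    by (subst SUP_commute) (simp add: SUP_dense_eq[OF dense cont])
  moreover have "(INF x\<in>K. SUP k. f k x \<omega>) = (SUP n. INF x\<in>D. SUP k\<in>{..n}. f k x \<omega>)" for \<omega>
    by (simp add: INF_SUP_eq_SUP_INF_compact[OF K cont]
        INF_dense_eq[OF dense continuous_on_finite_SUP[OF cont]])
  ultimately have "(\<lambda>\<omega>. SUP x\<in>K. \<bar>SUP k. f k x \<omega>\<bar>) =
      (\<lambda>\<omega>. max (SUP k. SUP x\<in>D. f k x \<omega>) (- (SUP n. INF x\<in>D. SUP k\<in>{..n}. f k x \<omega>)))"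
    by (simp add: SUP_abs_ereal)
  moreover have "f k x \<in> borel_measurable N" if "x \<in> D" for k x using meas D(2) that by blast
  ultimately show ?thesis
    using D(1) by (simp only:) (intro borel_measurable_max borel_measurable_uminus_ereal
      borel_measurable_SUP borel_measurable_INF; simp)
qed

lemma cm3_eq_SUP_nat:
  "cm3 a Z t \<omega> x =
    (SUP k. case from_nat k of (j, i) \<Rightarrow> ereal (a i j x * Z (t - int i) j \<omega>))"
  (is "_ = (SUP k. ?h (from_nat k))")
proof -
  have "cm3 a Z t \<omega> x = (SUP p. ?h p)"
    unfolding cm3_def
  proof (rule antisym)
    show "(SUP j. SUP i. ereal (a i j x * Z (t - int i) j \<omega>)) \<le> (SUP p. ?h p)"
    proof (intro SUP_least)
      fix j i
      show "ereal (a i j x * Z (t - int i) j \<omega>) \<le> (SUP p. ?h p)"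
        by (rule SUP_upper2[of "(j, i)"]) simp_all
    qed
    show "(SUP p. ?h p) \<le> (SUP j. SUP i. ereal (a i j x * Z (t - int i) j \<omega>))"
    proof (rule SUP_least)
      fix p :: "int \<times> nat"
      obtain j i where "p = (j, i)" by force
      then show "?h p \<le> (SUP j. SUP i. ereal (a i j x * Z (t - int i) j \<omega>))"
        by (auto intro!: SUP_upper2[of j] SUP_upper2[of i])
    qed
  qed
  also have "\<dots> = (SUP k. ?h (from_nat k))"
    using SUP_image[of ?h from_nat UNIV] by (simp add: comp_def surj_from_nat)
  finally show ?thesis .
qed

text \<open>
  No null set is excepted, as an incomplete probability space need not contain its subsets as
  events. Where the path takes negative
  values, the absolute value in the norm brings in its infimum over the cube.
\<close>

lemma measurable_sup_norm_cm3:
  fixes a :: "nat \<Rightarrow> int \<Rightarrow> real^'q \<Rightarrow> real"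
  assumes cont: "\<And>i j. continuous_on (cbox 0 1) (a i j)"
    and Z: "\<And>i j. Z i j \<in> borel_measurable N"
  shows "(\<lambda>\<omega>. sup_norm (cm3 a Z t \<omega>)) \<in> borel_measurable N"
  unfolding sup_norm_def cm3_eq_SUP_nat
proof (rule measurable_SUP_abs_SUP[OF compact_cbox])
  show "continuous_on (cbox 0 1)
      (\<lambda>x. case from_nat k of (j, i) \<Rightarrow> ereal (a i j x * Z (t - int i) j \<omega>))" for k \<omega>
    by (cases "from_nat k :: int \<times> nat") (auto intro!: continuous_intros cont)
  show "(\<lambda>\<omega>. case from_nat k of (j, i) \<Rightarrow> ereal (a i j x * Z (t - int i) j \<omega>)) \<in> borel_measurable N"
    for k x
    using Z by (auto split: prod.split)
qed

section \<open>Products of independent unit-Frechet variables\<close>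

lemma (in prob_space) AE_unit_frechet_pos:
  assumes "unit_frechet M X"
  shows "AE \<omega> in M. X \<omega> > 0"
proof -
  have [measurable]: "X \<in> borel_measurable M"
    and cdf: "\<And>z. z > 0 \<Longrightarrow> prob {\<omega> \<in> space M. X \<omega> \<le> z} = exp (- 1 / z)"
    using assms by (auto simp: unit_frechet_def)
  \<comment> \<open>The distribution function is prescribed for positive arguments only; its limit at \<open>0\<close> is \<open>0\<close>.\<close>
  have "prob {\<omega> \<in> space M. X \<omega> \<le> 0} \<le> exp (- real (Suc n))" for n
  proof -
    have "prob {\<omega> \<in> space M. X \<omega> \<le> 0} \<le> prob {\<omega> \<in> space M. X \<omega> \<le> 1 / real (Suc n)}"
      by (intro finite_measure_mono) (auto intro: order_trans)
    then show ?thesis using cdf[of "1 / real (Suc n)"] by simp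
  qed
  moreover have "(\<lambda>n. exp (- real (Suc n))) \<longlonglongrightarrow> 0"
    by real_asymp
  ultimately have "prob {\<omega> \<in> space M. X \<omega> \<le> 0} \<le> 0"
    by (intro LIMSEQ_le_const) auto
  then have "prob {\<omega> \<in> space M. X \<omega> \<le> 0} = 0" using measure_nonneg[of M] by (intro antisym)
  then have "AE \<omega> in M. \<not> X \<omega> \<le> 0"
    by (subst AE_iff_measurable[OF _ refl]) (simp_all add: emeasure_eq_measure)
  then show ?thesis by (simp add: not_le)
qed

lemma (in prob_space) unit_frechet_distr_unique:
  assumes X: "unit_frechet M X" and Y: "unit_frechet M Y"
  shows "distr M borel X = distr M borel Y"
proof (rule cdf_unique)
  have meas[measurable]: "X \<in> borel_measurable M" "Y \<in> borel_measurable M"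
    using assms by (auto simp: unit_frechet_def)
  then show "real_distribution (distr M borel X)" "real_distribution (distr M borel Y)" by auto
  have cdf_eq: "cdf (distr M borel V) z = (if z > 0 then exp (- 1 / z) else 0)"
    if V: "unit_frechet M V" for V z
  proof -
    have [measurable]: "V \<in> borel_measurable M"
      and cdf: "z > 0 \<Longrightarrow> prob {\<omega> \<in> space M. V \<omega> \<le> z} = exp (- 1 / z)"
      using V by (auto simp: unit_frechet_def)
    have "cdf (distr M borel V) z = prob {\<omega> \<in> space M. V \<omega> \<le> z}"
      by (simp add: cdf_def measure_distr vimage_def Int_def conj_commute)
    also have "\<dots> = (if z > 0 then exp (- 1 / z) else 0)"
    proof (cases "z > 0")
      case False
      have "AE \<omega> in M. \<omega> \<notin> {\<omega> \<in> space M. V \<omega> \<le> z}"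
        using AE_unit_frechet_pos[OF V] False by (auto elim!: eventually_mono)
      then have "prob {\<omega> \<in> space M. V \<omega> \<le> z} = 0" by (intro prob_eq_0[THEN iffD2]) auto
      with False show ?thesis by simp
    qed (simp add: cdf)
    finally show ?thesis .
  qed
  show "cdf (distr M borel X) = cdf (distr M borel Y)"
    by (simp add: fun_eq_iff cdf_eq[OF X] cdf_eq[OF Y])
qed

lemma (in prob_space) unit_frechet_scaled_le:
  assumes X: "unit_frechet M X" and "b \<ge> 0" "y > 0"
  shows "prob {\<omega> \<in> space M. b * X \<omega> \<le> y} = exp (- b / y)"
proof (cases "b = 0")
  case True
  with \<open>y > 0\<close> show ?thesis by (simp add: prob_space)
next
  case False
  with assms have b: "b > 0" by simp
  have "{\<omega> \<in> space M. b * X \<omega> \<le> y} = {\<omega> \<in> space M. X \<omega> \<le> y / b}"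
    using b by (auto simp: field_simps)
  then show ?thesis using X b \<open>y > 0\<close> by (simp add: unit_frechet_def)
qed

text \<open>
  For finitely many indices the product of the distribution functions turns into a sum in the
  exponent. An enumeration of the index type and continuity of the measure from above give the rest.
\<close>

lemma (in prob_space) unit_frechet_max_linear:
  fixes X :: "'p::countable \<Rightarrow> 'a \<Rightarrow> real"
  assumes inf: "infinite (UNIV :: 'p set)"
    and indep: "indep_vars (\<lambda>_. borel) X UNIV"
    and X: "\<And>p. unit_frechet M (X p)"
    and b: "\<And>p. b p \<ge> 0" and sum: "(b has_sum B) UNIV" and y: "y > 0"
  shows "prob {\<omega> \<in> space M. \<forall>p. b p * X p \<omega> \<le> y} = exp (- B / y)"
proof -
  have [measurable]: "X p \<in> borel_measurable M" for p using X by (simp add: unit_frechet_def)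
  obtain e :: "nat \<Rightarrow> 'p" where e: "bij e"
    using bij_betw_from_nat_into[OF _ inf] by auto
  define E where "E n = {\<omega> \<in> space M. \<forall>k\<le>n. b (e k) * X (e k) \<omega> \<le> y}" for n
  have "prob (E n) = exp (- (\<Sum>k\<le>n. b (e k)) / y)" for n
  proof -
    let ?J = "e ` {..n}"
    have "E n = (\<Inter>p\<in>?J. X p -` {x. b p * x \<le> y} \<inter> space M)"
      by (auto simp: E_def)
    also have "prob \<dots> = (\<Prod>p\<in>?J. prob (X p -` {x. b p * x \<le> y} \<inter> space M))"
      by (rule indep_varsD[OF indep]) auto
    also have "\<dots> = (\<Prod>p\<in>?J. exp (- b p / y))"
    proof (rule prod.cong[OF refl])
      fix p
      have "X p -` {x. b p * x \<le> y} \<inter> space M = {\<omega> \<in> space M. b p * X p \<omega> \<le> y}" by auto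
      then show "prob (X p -` {x. b p * x \<le> y} \<inter> space M) = exp (- b p / y)"
        using unit_frechet_scaled_le[OF X b y] by simp
    qed
    also have "\<dots> = (\<Prod>k\<le>n. exp (- b (e k) / y))"
      by (rule prod.reindex_cong[OF inj_on_subset[OF bij_is_inj[OF e]]]) auto
    also have "\<dots> = exp (- (\<Sum>k\<le>n. b (e k)) / y)"
      by (simp add: exp_sum[symmetric] sum_negf sum_divide_distrib)
    finally show ?thesis .
  qed
  moreover have "(\<lambda>n. prob (E n)) \<longlonglongrightarrow> prob (\<Inter>n. E n)"
    by (rule finite_Lim_measure_decseq) (auto simp: E_def decseq_def)
  moreover have "(\<Inter>n. E n) = {\<omega> \<in> space M. \<forall>p. b p * X p \<omega> \<le> y}"
  proof -
    have "(\<forall>n. \<forall>k\<le>n. b (e k) * X (e k) \<omega> \<le> y) \<longleftrightarrow> (\<forall>p. b p * X p \<omega> \<le> y)" for \<omega>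
    proof (intro iffI allI)
      fix p assume *: "\<forall>n. \<forall>k\<le>n. b (e k) * X (e k) \<omega> \<le> y"
      obtain k where "p = e k" using bij_is_surj[OF e] by (rule surjE)
      with * show "b p * X p \<omega> \<le> y" by blast
    qed simp
    then show ?thesis unfolding E_def by blast
  qed
  moreover have "(\<lambda>n. exp (- (\<Sum>k\<le>n. b (e k)) / y)) \<longlonglongrightarrow> exp (- B / y)"
  proof -
    have "((\<lambda>k. b (e k)) has_sum B) UNIV" using has_sum_reindex_bij_betw[OF e] sum by blast
    then have "(\<lambda>n. \<Sum>k\<le>n. b (e k)) \<longlonglongrightarrow> B"
      unfolding sums_def_le[symmetric] by (rule has_sum_imp_sums)
    then show ?thesis using y by (intro tendsto_intros) auto
  qed
  ultimately show ?thesis using LIMSEQ_unique by simp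
qed

text \<open>
  An i.i.d. family has a product law with equal factors, which no injective relabelling changes.
  Time shifts of the shocks are such relabellings.
\<close>

lemma (in prob_space) iid_reindex:
  fixes X :: "'p \<Rightarrow> 'a \<Rightarrow> 'b"
  assumes indep: "indep_vars (\<lambda>_. N) X UNIV"
    and id: "\<And>p q. distr M N (X p) = distr M N (X q)" and f: "inj f"
  shows "distr M (Pi\<^sub>M UNIV (\<lambda>_. N)) (\<lambda>\<omega> p. X (f p) \<omega>) = distr M (Pi\<^sub>M UNIV (\<lambda>_. N)) (\<lambda>\<omega> p. X p \<omega>)"
proof -
  fix p0 :: 'p
  have rv[measurable]: "X p \<in> measurable M N" for p using indep by (auto simp: indep_vars_def)
  define F where "F = distr M N (X p0)"
  interpret F: prob_space F unfolding F_def by (rule prob_space_distr) simp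
  have sets_F: "sets (Pi\<^sub>M UNIV (\<lambda>_::'p. F)) = sets (Pi\<^sub>M UNIV (\<lambda>_. N))"
    by (rule sets_PiM_cong) (simp_all add: F_def)
  have meas: "(\<lambda>\<omega> p. X p \<omega>) \<in> measurable M (Pi\<^sub>M UNIV (\<lambda>_. N))"
    by (rule measurable_PiM_single') (auto simp: measurable_space[OF rv])
  have "(\<lambda>p. distr M N (X p)) = (\<lambda>_. F)" using id by (auto simp: F_def)
  then have law: "distr M (Pi\<^sub>M UNIV (\<lambda>_. N)) (\<lambda>\<omega> p. X p \<omega>) = Pi\<^sub>M UNIV (\<lambda>_. F)"
    using indep_vars_iff_distr_eq_PiM[where X = X and I = UNIV and M' = "\<lambda>_. N",
        OF UNIV_not_empty rv] indep
    by (simp add: restrict_UNIV)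
  have shift: "(\<lambda>z p. z (f p)) \<in> measurable (Pi\<^sub>M UNIV (\<lambda>_. N)) (Pi\<^sub>M UNIV (\<lambda>_. N))"
    by (rule measurable_PiM_single') (auto simp: space_PiM)
  have "distr M (Pi\<^sub>M UNIV (\<lambda>_. N)) (\<lambda>\<omega> p. X (f p) \<omega>) =
      distr (Pi\<^sub>M UNIV (\<lambda>_. F)) (Pi\<^sub>M UNIV (\<lambda>_. N)) (\<lambda>z p. z (f p))"
    using distr_distr[OF shift meas] by (simp add: law comp_def)
  also have "\<dots> = distr (Pi\<^sub>M UNIV (\<lambda>_. F)) (Pi\<^sub>M UNIV (\<lambda>_. F)) (\<lambda>z p. z (f p))"
    by (rule distr_cong) (simp_all add: sets_F)
  also have "\<dots> = Pi\<^sub>M UNIV (\<lambda>_. F)"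
    using distr_PiM_reindex[of UNIV "\<lambda>_. F" f UNIV] F.prob_space_axioms f by (simp add: restrict_UNIV)
  finally show ?thesis by (simp add: law)
qed

section \<open>The process and its maxima over time\<close>

text \<open>
  The paths at times \<open>t + h\<close> are the same measurable function of the shocks shifted by \<open>h\<close> as the
  paths at times \<open>t\<close> are of the shocks themselves.
\<close>

lemma (in prob_space) stationary_sup_norm_cm3:
  fixes a :: "nat \<Rightarrow> int \<Rightarrow> real^'q \<Rightarrow> real"
  assumes cont: "\<And>i j. continuous_on (cbox 0 1) (a i j)"
    and Z: "\<And>i j. unit_frechet M (Z i j)"
    and indep: "indep_vars (\<lambda>_. borel) (\<lambda>(i, j). Z i j) UNIV"
  shows "stationary M (\<lambda>t \<omega>. sup_norm (cm3 a Z t \<omega>))"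
proof -
  let ?B = "Pi\<^sub>M UNIV (\<lambda>_::int \<times> int. borel :: real measure)"
  let ?\<Phi> = "\<lambda>z t. sup_norm (cm3 a (\<lambda>i j z. z (i, j)) t z)"
  have meas: "Z i j \<in> borel_measurable M" for i j using Z by (simp add: unit_frechet_def)
  have \<Phi>: "?\<Phi> \<in> measurable ?B (Pi\<^sub>M UNIV (\<lambda>_. borel))"
    by (rule measurable_PiM_single') (auto intro!: measurable_sup_norm_cm3[OF cont])
  have shifted: "(\<lambda>\<omega> p. (case p of (i, j) \<Rightarrow> Z (i + h) j) \<omega>) \<in> measurable M ?B" for h
    by (rule measurable_PiM_single') (auto simp: meas split: prod.split)
  have law: "distr M (Pi\<^sub>M UNIV (\<lambda>_. borel)) (\<lambda>\<omega> t. sup_norm (cm3 a Z (t + h) \<omega>)) =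
      distr (distr M ?B (\<lambda>\<omega> p. (case p of (i, j) \<Rightarrow> Z (i + h) j) \<omega>)) (Pi\<^sub>M UNIV (\<lambda>_. borel)) ?\<Phi>" for h
    unfolding distr_distr[OF \<Phi> shifted] by (simp add: comp_def cm3_def[abs_def] algebra_simps)
  have shift_law: "distr M ?B (\<lambda>\<omega> p. (case p of (i, j) \<Rightarrow> Z (i + h) j) \<omega>) =
      distr M ?B (\<lambda>\<omega> p. (case p of (i, j) \<Rightarrow> Z i j) \<omega>)" for h
  proof -
    have "distr M ?B (\<lambda>\<omega> p. (case (case p of (i, j) \<Rightarrow> (i + h, j)) of (i, j) \<Rightarrow> Z i j) \<omega>) =
        distr M ?B (\<lambda>\<omega> p. (case p of (i, j) \<Rightarrow> Z i j) \<omega>)"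
      by (rule iid_reindex[OF indep])
         (auto intro!: unit_frechet_distr_unique Z injI split: prod.splits)
    then show ?thesis by (simp add: case_prod_unfold)
  qed
  show ?thesis
    unfolding stationary_def
    using measurable_sup_norm_cm3[OF cont meas] law[of h for h] law[of 0] shift_law[of h for h]
    by simp
qed

lemma stationary_marginal:
  assumes "stationary M Y" and A: "A \<in> sets borel"
  shows "measure M {\<omega> \<in> space M. Y t \<omega> \<in> A} = measure M {\<omega> \<in> space M. Y 0 \<omega> \<in> A}"
proof -
  let ?P = "Pi\<^sub>M UNIV (\<lambda>_::int. borel :: ereal measure)"
  have Y: "Y t \<in> borel_measurable M" for t using assms(1) by (simp add: stationary_def)
  have path: "(\<lambda>\<omega> s. Y (s + h) \<omega>) \<in> measurable M ?P" for h
    by (rule measurable_PiM_single') (auto intro: Y)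
  have C: "{z \<in> space ?P. z 0 \<in> A} \<in> sets ?P" using A by measurable
  have "measure (distr M ?P (\<lambda>\<omega> s. Y (s + h) \<omega>)) {z \<in> space ?P. z 0 \<in> A} =
      measure M {\<omega> \<in> space M. Y h \<omega> \<in> A}" for h
    by (subst measure_distr[OF path C]) (rule arg_cong[where f = "measure M"], auto simp: space_PiM)
  from this[of t] this[of 0] assms(1) show ?thesis by (simp add: stationary_def)
qed

lemma le_sup_norm_cbox:
  fixes f :: "real^'q \<Rightarrow> real"
  assumes "continuous_on (cbox 0 1) f" "x \<in> cbox 0 1"
  shows "\<bar>f x\<bar> \<le> sup_norm f"
  unfolding sup_norm_def
proof (rule cSUP_upper[OF assms(2)])
  have "compact ((\<lambda>x. \<bar>f x\<bar>) ` cbox 0 1)"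
    by (intro compact_continuous_image continuous_intros assms(1)) simp
  then show "bdd_above ((\<lambda>x. \<bar>f x\<bar>) ` cbox 0 1)"
    by (simp add: compact_imp_bounded bounded_imp_bdd_above)
qed

lemma zero_in_unit_cube: "(0 :: real^'q) \<in> cbox 0 1"
  by (simp add: mem_box_cart)

lemma sup_norm_le:
  fixes f :: "real^'q \<Rightarrow> real"
  assumes "\<And>x. x \<in> cbox 0 1 \<Longrightarrow> \<bar>f x\<bar> \<le> c"
  shows "sup_norm f \<le> c"
  unfolding sup_norm_def by (rule cSUP_least) (use assms zero_in_unit_cube in auto)

lemma sup_norm_cm3_le_iff:
  fixes a :: "nat \<Rightarrow> int \<Rightarrow> real^'q \<Rightarrow> real"
  assumes pos: "\<And>i j x. x \<in> cbox 0 1 \<Longrightarrow> a i j x > 0"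
    and cont: "\<And>i j. continuous_on (cbox 0 1) (a i j)"
    and Z: "\<And>i j. Z i j \<omega> > 0"
  shows "sup_norm (cm3 a Z t \<omega>) \<le> ereal y \<longleftrightarrow>
    (\<forall>j i. sup_norm (a i j) * Z (t - int i) j \<omega> \<le> y)"
proof -
  have "cm3 a Z t \<omega> x \<ge> 0" if "x \<in> cbox 0 1" for x
    unfolding cm3_def using pos[OF that] Z
    by (intro SUP_upper2[OF UNIV_I]) (auto intro!: mult_nonneg_nonneg less_imp_le)
  then have "sup_norm (cm3 a Z t \<omega>) = (SUP x\<in>cbox 0 1. cm3 a Z t \<omega> x)"
    unfolding sup_norm_def by (intro SUP_cong) auto
  then have "sup_norm (cm3 a Z t \<omega>) \<le> ereal y \<longleftrightarrow>
      (\<forall>j i. \<forall>x\<in>cbox 0 1. a i j x * Z (t - int i) j \<omega> \<le> y)"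
    by (auto simp: cm3_def SUP_le_iff)
  moreover have "(\<forall>x\<in>cbox 0 1. a i j x * Z (t - int i) j \<omega> \<le> y) \<longleftrightarrow>
      sup_norm (a i j) * Z (t - int i) j \<omega> \<le> y" for i j
  proof -
    have "(\<forall>x\<in>cbox 0 1. a i j x \<le> c) \<longleftrightarrow> sup_norm (a i j) \<le> c" for c
    proof
      assume "\<forall>x\<in>cbox 0 1. a i j x \<le> c"
      then show "sup_norm (a i j) \<le> c" using pos by (intro sup_norm_le) (simp add: abs_of_pos)
    next
      assume "sup_norm (a i j) \<le> c"
      then show "\<forall>x\<in>cbox 0 1. a i j x \<le> c"
        using le_sup_norm_cbox[OF cont] by (meson abs_le_D1 order_trans)
    qed
    then show ?thesis by (simp add: pos_le_divide_eq[OF Z, symmetric])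
  qed
  ultimately show ?thesis by simp
qed

text \<open>
  The quantification over observation times and lags is regrouped by the time \<open>s = t - i\<close> of the
  shock.
\<close>

lemma window_max_bound_iff:
  assumes Z: "\<And>s j. z s j > (0::real)" and y: "y \<ge> 0"
  shows "(\<forall>t\<in>{1..int n}. \<forall>j i. \<alpha> j i * z (t - int i) j \<le> y) \<longleftrightarrow>
    (\<forall>s j. window_max (\<alpha> j) n s * z s j \<le> y)"
proof -
  have quot: "y / z s j \<ge> 0" for s j using y less_imp_le[OF Z] by simp
  have "(\<forall>i. \<alpha> j i * z (t - int i) j \<le> y) \<longleftrightarrow> (\<forall>s. zero_extension (\<alpha> j) (t - s) \<le> y / z s j)" for t j
  proof (intro iffI allI)
    fix s assume "\<forall>i. \<alpha> j i * z (t - int i) j \<le> y"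
    from spec[OF this, of "nat (t - s)"] show "zero_extension (\<alpha> j) (t - s) \<le> y / z s j"
      using quot by (auto simp: zero_extension_def pos_le_divide_eq[OF Z])
  next
    fix i assume "\<forall>s. zero_extension (\<alpha> j) (t - s) \<le> y / z s j"
    from spec[OF this, of "t - int i"] show "\<alpha> j i * z (t - int i) j \<le> y"
      by (simp add: zero_extension_def pos_le_divide_eq[OF Z])
  qed
  then have "(\<forall>t\<in>{1..int n}. \<forall>j i. \<alpha> j i * z (t - int i) j \<le> y) \<longleftrightarrow>
      (\<forall>s j. \<forall>t\<in>{1..int n}. zero_extension (\<alpha> j) (t - s) \<le> y / z s j)"
    by blast
  moreover have "window_max (\<alpha> j) n s * z s j \<le> y \<longleftrightarrow>
      (\<forall>t\<in>{1..int n}. zero_extension (\<alpha> j) (t - s) \<le> y / z s j)" for s j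
    by (simp only: pos_le_divide_eq[OF Z, symmetric] window_max_le_iff[OF quot])
  ultimately show ?thesis by simp
qed

text \<open>
  Almost surely all shocks are positive, and then the norm of the process at time \<open>t\<close> is the
  supremum of \<open>\<parallel>a i j\<parallel> Z\<^bsub>t-i\<^esub>\<close>. A bound on it for all times of a window is one bound on
  each shock, with the window maximum as its coefficient.
\<close>

lemma (in prob_space) prob_cm3_window_le:
  fixes a :: "nat \<Rightarrow> int \<Rightarrow> real^'q \<Rightarrow> real"
  assumes pos: "\<And>i j x. x \<in> cbox 0 1 \<Longrightarrow> a i j x > 0"
    and cont: "\<And>i j. continuous_on (cbox 0 1) (a i j)"
    and Z: "\<And>i j. unit_frechet M (Z i j)"
    and indep: "indep_vars (\<lambda>_. borel) (\<lambda>(i, j). Z i j) UNIV"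
    and S: "((\<lambda>(s, j). window_max (\<lambda>i. sup_norm (a i j)) n s) has_sum S) UNIV"
    and n: "n > 0" and y: "y > 0"
  shows "prob {\<omega> \<in> space M. (MAX t\<in>{1..int n}. sup_norm (cm3 a Z t \<omega>)) \<le> ereal y} = exp (- S / y)"
proof -
  let ?w = "\<lambda>s j. window_max (\<lambda>i. sup_norm (a i j)) n s"
  have meas[measurable]: "Z i j \<in> borel_measurable M" for i j using Z by (simp add: unit_frechet_def)
  note [measurable] = measurable_sup_norm_cm3[OF cont meas]
  have "AE \<omega> in M. \<forall>s j. Z s j \<omega> > 0"
    using AE_unit_frechet_pos[OF Z] by (simp add: AE_all_countable)
  then have ae: "AE \<omega> in M. (\<forall>t\<in>{1..int n}. sup_norm (cm3 a Z t \<omega>) \<le> ereal y) \<longleftrightarrow>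
      (\<forall>s j. ?w s j * Z s j \<omega> \<le> y)"
  proof eventually_elim
    case (elim \<omega>)
    then show ?case
      using window_max_bound_iff[of "\<lambda>s j. Z s j \<omega>" y n "\<lambda>j i. sup_norm (a i j)"] y
      by (simp add: sup_norm_cm3_le_iff[OF pos cont])
  qed
  have "prob {\<omega> \<in> space M. (MAX t\<in>{1..int n}. sup_norm (cm3 a Z t \<omega>)) \<le> ereal y} =
      prob {\<omega> \<in> space M. \<forall>t\<in>{1..int n}. sup_norm (cm3 a Z t \<omega>) \<le> ereal y}"
    using n by (simp add: Max_le_iff)
  \<comment> \<open>The two events agree where all shocks are positive.\<close>
  also have "\<dots> = prob {\<omega> \<in> space M. \<forall>s j. ?w s j * Z s j \<omega> \<le> y}"
  proof (rule finite_measure_eq_AE)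
    show "AE \<omega> in M. \<omega> \<in> {\<omega> \<in> space M. \<forall>t\<in>{1..int n}. sup_norm (cm3 a Z t \<omega>) \<le> ereal y} \<longleftrightarrow>
        \<omega> \<in> {\<omega> \<in> space M. \<forall>s j. ?w s j * Z s j \<omega> \<le> y}"
      using ae by eventually_elim simp
  qed measurable
  also have "\<dots> = prob {\<omega> \<in> space M. \<forall>p. (case p of (s, j) \<Rightarrow> ?w s j) * (case p of (s, j) \<Rightarrow> Z s j) \<omega> \<le> y}"
    by simp
  also have "\<dots> = exp (- S / y)"
    by (rule unit_frechet_max_linear[OF _ indep _ _ S y])
       (simp_all add: Z window_max_nonneg finite_prod case_prod_unfold)
  finally show ?thesis .
qed

theorem proposition2p6:
  fixes M :: "'a measure"
    and a :: "nat \<Rightarrow> int \<Rightarrow> real^'q \<Rightarrow> real"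
    and Z :: "int \<Rightarrow> int \<Rightarrow> 'a \<Rightarrow> real"
  assumes "prob_space M"
    and "\<And>i j x. x \<in> cbox 0 1 \<Longrightarrow> a i j x > 0"
    and "\<And>i j. continuous_on (cbox 0 1) (a i j)"
    and "\<And>i j. unit_frechet M (Z i j)"
    and "prob_space.indep_vars M (\<lambda>_. borel) (\<lambda>(i, j). Z i j) UNIV"
    and "(\<lambda>(j, i). sup_norm (a i j)) summable_on UNIV"
  shows "has_extremal_index M (\<lambda>t \<omega>. sup_norm (cm3 a Z t \<omega>))
     (1 / (\<Sum>\<^sub>\<infinity>j. \<Sum>\<^sub>\<infinity>i. sup_norm (a i j)) * (\<Sum>\<^sub>\<infinity>j. SUP i. sup_norm (a i j)))"
proof -
  interpret prob_space M by fact
  note pos = assms(2) and cont = assms(3) and Z = assms(4) and indep = assms(5) and summ = assms(6)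
  let ?Y = "\<lambda>t \<omega>. sup_norm (cm3 a Z t \<omega>)"
  define \<alpha> where "\<alpha> j i = sup_norm (a i j)" for i j
  define A where "A = (\<Sum>\<^sub>\<infinity>(j, i). \<alpha> j i)"
  define B where "B = (\<Sum>\<^sub>\<infinity>j. SUP i. \<alpha> j i)"
  have \<alpha>_pos: "\<alpha> j i > 0" for j i
  proof -
    have "0 < a i j 0" by (rule pos[OF zero_in_unit_cube])
    also have "\<dots> \<le> \<alpha> j i"
      using le_sup_norm_cbox[OF cont zero_in_unit_cube] by (simp add: \<alpha>_def abs_le_D1)
    finally show ?thesis .
  qed
  have \<alpha>_summ: "(\<lambda>(j, i). \<alpha> j i) summable_on UNIV" using summ by (simp add: \<alpha>_def)
  obtain S where S: "\<And>n. ((\<lambda>(s, j). window_max (\<alpha> j) n s) has_sum S n) UNIV"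
    and S1: "S 1 = A" and S_lim: "(\<lambda>n. S n / n) \<longlonglongrightarrow> B"
    using window_max_sum_asymptotics[OF less_imp_le[OF \<alpha>_pos] \<alpha>_summ] unfolding A_def B_def by blast
  have window: "prob {\<omega> \<in> space M. (MAX t\<in>{1..int n}. ?Y t \<omega>) \<le> ereal y} = exp (- S n / y)"
    if "n > 0" "y > 0" for n y
    by (rule prob_cm3_window_le[OF pos cont Z indep S[of n, unfolded \<alpha>_def[abs_def]] that])

  have A_eq: "A = (\<Sum>\<^sub>\<infinity>j. \<Sum>\<^sub>\<infinity>i. \<alpha> j i)"
    and rows: "(\<lambda>j. \<Sum>\<^sub>\<infinity>i. \<alpha> j i) summable_on UNIV"
    using infsum_Sigma'_banach[of \<alpha> UNIV "\<lambda>_. UNIV"] summable_on_Sigma_banach[of \<alpha> UNIV "\<lambda>_. UNIV"]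
      \<alpha>_summ by (simp_all add: A_def)
  have row: "\<alpha> j summable_on UNIV" for j
    using summable_on_SigmaD1[of \<alpha> UNIV "\<lambda>_. UNIV" j] \<alpha>_summ by simp
  note bounds = nonneg_summable_on_bounds[of "\<alpha> j" for j, OF less_imp_le[OF \<alpha>_pos] row]
  have A_pos: "A > 0"
  proof -
    have "\<alpha> 0 0 \<le> A"
      using finite_sum_le_infsum[OF \<alpha>_summ, of "{(0, 0)}"] \<alpha>_pos
      by (auto simp: A_def less_imp_le)
    with \<alpha>_pos[of 0 0] show ?thesis by simp
  qed
  have B_nonneg: "0 \<le> B" unfolding B_def by (rule infsum_nonneg) (rule bounds)
  have B_le: "B \<le> A"
  proof -
    have "(\<lambda>j. SUP i. \<alpha> j i) summable_on UNIV"
      by (rule summable_on_comparison_test[OF rows]) (use bounds in auto)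
    then show ?thesis
      unfolding A_eq B_def by (rule infsum_mono[OF _ rows]) (rule bounds)
  qed

  have stat: "stationary M ?Y" by (rule stationary_sup_norm_cm3[OF cont Z indep])
  have Y_meas[measurable]: "?Y t \<in> borel_measurable M" for t using stat by (simp add: stationary_def)
  \<comment> \<open>Stationarity moves the tail event to time \<open>1\<close>, where it belongs to the window of length \<open>1\<close>.\<close>
  have tail: "prob {\<omega> \<in> space M. ?Y 0 \<omega> > ereal x} = 1 - exp (- A / x)" if x: "x > 0" for x
  proof -
    have "prob {\<omega> \<in> space M. ?Y 0 \<omega> > ereal x} = 1 - prob {\<omega> \<in> space M. ?Y 0 \<omega> \<in> {..ereal x}}"
      by (subst prob_compl[symmetric]) (auto intro!: arg_cong[where f = prob])
    also have "prob {\<omega> \<in> space M. ?Y 0 \<omega> \<in> {..ereal x}} = prob {\<omega> \<in> space M. ?Y 1 \<omega> \<in> {..ereal x}}"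
      by (rule stationary_marginal[OF stat, symmetric]) simp
    also have "\<dots> = exp (- A / x)" using window[of 1 x] x by (simp add: S1[unfolded One_nat_def])
    finally show ?thesis .
  qed
  \<comment> \<open>Hence the tail constant is \<open>A\<close>, and the factor \<open>1 / A\<close> in the index cancels against it.\<close>
  have "((\<lambda>x. x * prob {\<omega> \<in> space M. ?Y 0 \<omega> > ereal x}) \<longlongrightarrow> A) at_top"
  proof -
    have "((\<lambda>x. x * (1 - exp (- A / x))) \<longlongrightarrow> A) at_top" using A_pos by real_asymp
    moreover have "\<forall>\<^sub>F x in at_top. x * (1 - exp (- A / x)) = x * prob {\<omega> \<in> space M. ?Y 0 \<omega> > ereal x}"
      using eventually_gt_at_top[of 0] by eventually_elim (simp add: tail)
    ultimately show ?thesis by (rule Lim_transform_eventually)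
  qed
  moreover have "(\<lambda>n::nat. prob {\<omega> \<in> space M. (MAX t\<in>{1..int n}. ?Y t \<omega>) \<le> ereal (real n * x)})
      \<longlonglongrightarrow> exp (- (1 / A * B) * A / x)" if x: "x > 0" for x
  proof -
    have "(\<lambda>n. exp (- (S n / n) / x)) \<longlonglongrightarrow> exp (- B / x)"
      using x by (intro tendsto_intros S_lim) auto
    moreover have "\<forall>\<^sub>F n in sequentially. exp (- (S n / n) / x) =
        prob {\<omega> \<in> space M. (MAX t\<in>{1..int n}. ?Y t \<omega>) \<le> ereal (real n * x)}"
      using eventually_gt_at_top[of 0] by eventually_elim (use window x in \<open>simp add: field_simps\<close>)
    ultimately have "(\<lambda>n. prob {\<omega> \<in> space M. (MAX t\<in>{1..int n}. ?Y t \<omega>) \<le> ereal (real n * x)})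
        \<longlonglongrightarrow> exp (- B / x)"
      by (rule Lim_transform_eventually)
    then show ?thesis using A_pos by simp
  qed
  ultimately have "has_extremal_index M ?Y (1 / A * B)"
    unfolding has_extremal_index_def
    using stat A_pos B_nonneg B_le by (auto intro!: exI[of _ A])
  then show ?thesis unfolding A_eq B_def \<alpha>_def .
qed

end
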